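(* Let $n\ge 2$ and let $\mathcal{P}_e(SD_{8n})$ be the enhanced power graph of the semidihedral group $SD_{8n}$, with identity element $e$. Then $Ecc(\mathcal{P}_e(SD_{8n}))=\mathcal{P}_e(SD_{8n})\setminus\{e\}$, i.e. the eccentric subgraph of $\mathcal{P}_e(SD_{8n})$ is the graph obtained by deleting the vertex $e$.
   Context: For $n\ge 2$, the semidihedral group of order $8n$ is $SD_{8n}=\langle a,b : a^{4n}=b^2=e,\ ba=a^{2n-1}b\rangle$. The enhanced power graph $\mathcal{P}_e(G)$ of a finite group $G$ is the simple undirected graph with vertex set $G$ in which two distinct vertices $x,y$ are adjacent if and only if $x,y\in\langle z\rangle$ for some $z\in G$. In a connected graph $\Gamma$, $d(u,v)$ is the usual (shortest-path) distance and $ecc(u)=\max_v d(u,v)$. A vertex $v$ is an eccentric vertex for $u$ if $d(u,v)=ecc(u)$, and $v$ is an eccentric vertex of $\Gamma$ if it is an eccentric vertex for some vertex of $\Gamma$. The eccentric subgraph $Ecc(\Gamma)$ is the subgraph of $\Gamma$ induced by the eccentric vertices of $\Gamma$. *)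

theory Defs
  imports "HOL-Algebra.Generated_Groups" "Graph_Theory.Graph_Theory"
begin

section \<open>Groups given by generators and relations\<close>

text \<open>
  A word over the generators \<open>'g\<close> and their formal inverses: the letter \<open>(g, True)\<close> stands
  for \<open>g\<close> and \<open>(g, False)\<close> for its inverse.
\<close>
type_synonym 'g word = "('g \<times> bool) list"

text \<open>
  A set \<open>R\<close> of pairs of words is read as a set of relations \<open>l = r\<close>. Two words represent the same
  element iff one can be turned into the other by inserting or deleting a subword of the form
  \<open>g g\<inverse>\<close> or \<open>g\<inverse> g\<close> and by applying relations of \<open>R\<close> in either direction.
\<close>
inductive word_step :: "('g word \<times> 'g word) set \<Rightarrow> 'g word \<Rightarrow> 'g word \<Rightarrow> bool"
  for R :: "('g word \<times> 'g word) set" where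
  cancel: "word_step R (u @ [(g, s), (g, \<not> s)] @ v) (u @ v)"
| relation: "(l, r) \<in> R \<Longrightarrow> word_step R (u @ l @ v) (u @ r @ v)"

definition word_rel :: "('g word \<times> 'g word) set \<Rightarrow> ('g word \<times> 'g word) set" where
  "word_rel R = {(u, v). equivclp (word_step R) u v}"

text \<open>The generators are all elements of the type \<open>'g\<close>.\<close>
definition presented_group :: "('g word \<times> 'g word) set \<Rightarrow> 'g word set monoid" where
  "presented_group R =
     \<lparr> carrier = UNIV // word_rel R,
       monoid.mult = (\<lambda>A B. \<Union>u\<in>A. \<Union>v\<in>B. word_rel R `` {u @ v}),
       one = word_rel R `` {[]} \<rparr>"


section \<open>Semidihedral groups\<close>

datatype sd_gen = Gen_a | Gen_b

abbreviation letter_a :: "sd_gen \<times> bool" where "letter_a \<equiv> (Gen_a, True)"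
abbreviation letter_b :: "sd_gen \<times> bool" where "letter_b \<equiv> (Gen_b, True)"

text \<open>The argument \<open>n\<close> yields the group usually denoted by \<open>SD\<^sub>8\<^sub>n\<close>, for \<open>n \<ge> 2\<close>.\<close>
definition semidihedral :: "nat \<Rightarrow> sd_gen word set monoid" where
  "semidihedral n = presented_group
     {(replicate (4 * n) letter_a, []),
      ([letter_b, letter_b], []),
      ([letter_b, letter_a], replicate (2 * n - 1) letter_a @ [letter_b])}"


section \<open>Enhanced power graphs\<close>

text \<open>A simple undirected graph is represented by the symmetric, loop-free digraph having both
  orientations of every edge as arcs.\<close>
definition enhanced_power_graph :: "('a, 'm) monoid_scheme \<Rightarrow> ('a, 'a \<times> 'a) pre_digraph" where
  "enhanced_power_graph G = with_proj
     \<lparr> pverts = carrier G,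
       parcs = {(x, y). x \<in> carrier G \<and> y \<in> carrier G \<and> x \<noteq> y \<and>
                  (\<exists>z\<in>carrier G. x \<in> generate G {z} \<and> y \<in> generate G {z})} \<rparr>"


section \<open>Eccentricity\<close>

definition graph_dist :: "('a, 'b) pre_digraph \<Rightarrow> 'a \<Rightarrow> 'a \<Rightarrow> ereal" where
  "graph_dist \<Gamma> u v = wf_digraph.\<mu> \<Gamma> (\<lambda>_. 1) u v"

text \<open>Since \<^const>\<open>Max\<close> is unspecified on infinite sets, this is meant for finite graphs only.\<close>
definition ecc :: "('a, 'b) pre_digraph \<Rightarrow> 'a \<Rightarrow> ereal" where
  "ecc \<Gamma> u = Max (graph_dist \<Gamma> u ` verts \<Gamma>)"

definition eccentric_verts :: "('a, 'b) pre_digraph \<Rightarrow> 'a set" where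
  "eccentric_verts \<Gamma> = {v \<in> verts \<Gamma>. \<exists>u\<in>verts \<Gamma>. graph_dist \<Gamma> u v = ecc \<Gamma> u}"

definition eccentric_subgraph :: "('a, 'b) pre_digraph \<Rightarrow> ('a, 'b) pre_digraph" where
  "eccentric_subgraph \<Gamma> = \<Gamma> \<restriction> eccentric_verts \<Gamma>"

end

theory Submission
  imports Defs "HOL-Algebra.Multiplicative_Group"
begin

text \<open>
  In an enhanced power graph the identity is adjacent to every other vertex, so its eccentricity is
  \<open>1\<close> and every other vertex is eccentric for it. The identity itself is at distance \<open>1\<close> from every
  other vertex \<open>x\<close>, so it is eccentric only if some \<open>x \<noteq> e\<close> has eccentricity \<open>1\<close>, that is, if
  \<open>x\<close> lies in a common cyclic subgroup with each element of the group. Hence for a finite nontrivial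
  group the claim follows once every \<open>x \<noteq> e\<close> has a partner \<open>y\<close> with which it shares no cyclic
  subgroup; this is \<open>group.eccentric_subgraph_enhanced_power_graph\<close>.

  In the semidihedral group every element is \<open>a\<^sup>i\<close> or \<open>a\<^sup>i b\<close>. For \<open>x = a\<^sup>i b\<close> the partner is \<open>a\<close>,
  since \<open>x\<close> and \<open>a\<close> do not commute. For \<open>x = a\<^sup>i \<noteq> e\<close> the partner is \<open>b\<close>: commuting
  does not decide this case, because \<open>a\<^sup>2\<^sup>n\<close> is central, but \<open>\<langle>b\<rangle> = {e, b}\<close> turns out to be a
  maximal cyclic subgroup (\<open>generator_of_b\<close>), and it does not contain \<open>x\<close>.

  These calculations use that \<open>a\<close> has order exactly \<open>4n\<close>. The relations only bound the order from
  above; that the presentation does not collapse is seen from an action on the integers modulo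
  \<open>4n\<close>, where \<open>a\<close> is the translation by \<open>1\<close> and \<open>b\<close> the multiplication by \<open>2n - 1\<close>.
\<close>

section \<open>Distances and eccentric vertices\<close>

context wf_digraph
begin

lemma graph_dist_eq_INF: "graph_dist G u v = (INF p\<in>{p. awalk u p v}. ereal (real (length p)))"
proof -
  have "awalk_cost (\<lambda>_. 1) p = real (length p)" for p :: "'b list"
    by (induction p) simp_all
  then show ?thesis
    by (simp add: graph_dist_def \<mu>_def)
qed

lemma graph_dist_le_length: "awalk u p v \<Longrightarrow> graph_dist G u v \<le> ereal (real (length p))"
  unfolding graph_dist_eq_INF by (rule INF_lower) simp

lemma graph_dist_geI:
  assumes "\<And>p. awalk u p v \<Longrightarrow> k \<le> length p"
  shows "ereal (real k) \<le> graph_dist G u v"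
  unfolding graph_dist_eq_INF by (rule INF_greatest) (simp add: assms)

lemma graph_dist_self:
  assumes "u \<in> verts G"
  shows "graph_dist G u u = 0"
proof (rule antisym)
  show "graph_dist G u u \<le> 0"
    using graph_dist_le_length[of u "[]" u] assms by (simp add: awalk_Nil_iff zero_ereal_def)
  show "0 \<le> graph_dist G u u"
    using graph_dist_geI[of u u 0] by (simp add: zero_ereal_def)
qed

lemma graph_dist_ge_1:
  assumes "u \<noteq> v"
  shows "1 \<le> graph_dist G u v"
proof -
  have "1 \<le> length p" if "awalk u p v" for p
    using that assms by (cases p) (auto simp: awalk_Nil_iff)
  then show ?thesis
    using graph_dist_geI[of u v 1] by (simp add: one_ereal_def)
qed

lemma graph_dist_ge_2:
  assumes "u \<noteq> v" "\<not> u \<rightarrow> v"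
  shows "2 \<le> graph_dist G u v"
proof -
  have "2 \<le> length p" if p: "awalk u p v" for p
  proof (rule ccontr)
    assume "\<not> 2 \<le> length p"
    then consider "p = []" | e where "p = [e]"
      by (cases p; cases "tl p") auto
    then show False
      using p assms by cases (auto simp: awalk_Nil_iff awalk_Cons_iff intro: in_arcs_imp_in_arcs_ends)
  qed
  then show ?thesis
    using graph_dist_geI[of u v 2] by simp
qed

lemma graph_dist_adjacent:
  assumes "u \<rightarrow> v" "u \<noteq> v"
  shows "graph_dist G u v = 1"
proof (rule antisym)
  from assms(1) obtain e where e: "e \<in> arcs G" "tail G e = u" "head G e = v"
    by auto
  then have "awalk u [e] v"
    by (auto simp: awalk_Cons_iff awalk_Nil_iff)
  from graph_dist_le_length[OF this] show "graph_dist G u v \<le> 1"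
    by (simp add: one_ereal_def)
qed (rule graph_dist_ge_1[OF assms(2)])

text \<open>
  The vertex \<open>c\<close> has distance at most \<open>1\<close> to everything, so all other vertices realise its
  eccentricity \<open>1\<close>. No vertex sees \<open>c\<close> at maximal distance: a vertex other than \<open>c\<close> is
  non-adjacent to some third vertex, hence has eccentricity at least \<open>2\<close>. Finiteness makes the maximum in the definition of
  eccentricity meaningful, and a second vertex is what keeps \<open>c\<close> from being eccentric for itself.
\<close>
lemma eccentric_verts_unique_dominating:
  assumes fin: "finite (verts G)" and c: "c \<in> verts G" and nontriv: "verts G \<noteq> {c}"
    and adj: "\<And>v. v \<in> verts G \<Longrightarrow> v \<noteq> c \<Longrightarrow> c \<rightarrow> v \<and> v \<rightarrow> c"
    and nonadj: "\<And>u. u \<in> verts G \<Longrightarrow> u \<noteq> c \<Longrightarrow> \<exists>w\<in>verts G. w \<noteq> u \<and> \<not> u \<rightarrow> w"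
  shows "eccentric_verts G = verts G - {c}"
proof -
  have ge: "graph_dist G u w \<le> ecc G u" if "w \<in> verts G" for u w
    unfolding ecc_def using fin that by simp
  have dist_c: "graph_dist G c v = 1" if "v \<in> verts G" "v \<noteq> c" for v
    using graph_dist_adjacent[of c v] adj[OF that] that by auto
  have img: "graph_dist G c ` verts G = {0, 1}"
    using c nontriv dist_c graph_dist_self[OF c] by force
  have ecc_c: "ecc G c = 1"
    unfolding ecc_def img by simp
  have "graph_dist G u c \<noteq> ecc G u" if u: "u \<in> verts G" for u
  proof (cases "u = c")
    case True
    then show ?thesis
      using ecc_c graph_dist_self[OF c] by simp
  next
    case False
    then obtain w where w: "w \<in> verts G" "w \<noteq> u" "\<not> u \<rightarrow> w"
      using nonadj u by blast
    have "graph_dist G u c = 1"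
      using graph_dist_adjacent[of u c] adj[OF u False] False by blast
    also have "(1::ereal) < 2"
      by simp
    also have "2 \<le> graph_dist G u w"
      using graph_dist_ge_2 w by auto
    also have "\<dots> \<le> ecc G u"
      by (rule ge[OF w(1)])
    finally show ?thesis
      by simp
  qed
  moreover have "v \<in> eccentric_verts G" if "v \<in> verts G" "v \<noteq> c" for v
    using dist_c[OF that] ecc_c c that unfolding eccentric_verts_def by force
  ultimately show ?thesis
    unfolding eccentric_verts_def by auto
qed

end

lemma induce_subgraph_minus_vertex: "G \<restriction> (verts G - {v}) = pre_digraph.del_vert G v"
  if "wf_digraph G"
proof -
  interpret wf_digraph G by fact
  show ?thesis
    by (rule pre_digraph.equality) (auto simp: induce_subgraph_def del_vert_def)
qed


section \<open>Enhanced power graphs\<close>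

lemma enhanced_power_graph_simps [simp]:
  "verts (enhanced_power_graph G) = carrier G"
  "x \<rightarrow>\<^bsub>enhanced_power_graph G\<^esub> y \<longleftrightarrow> x \<in> carrier G \<and> y \<in> carrier G \<and> x \<noteq> y \<and>
     (\<exists>z\<in>carrier G. x \<in> generate G {z} \<and> y \<in> generate G {z})"
  by (auto simp: enhanced_power_graph_def arcs_ends_def arc_to_ends_def)

lemma wf_digraph_enhanced_power_graph: "wf_digraph (enhanced_power_graph G)"
  by unfold_locales (auto simp: enhanced_power_graph_def)

text \<open>
  The identity belongs to every cyclic subgroup, hence it is adjacent to all other elements. The
  assumption on partners says that it is the only vertex with this property.
\<close>
lemma (in group) eccentric_subgraph_enhanced_power_graph:
  assumes fin: "finite (carrier G)" and nontriv: "carrier G \<noteq> {\<one>}"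
    and partner: "\<And>x. x \<in> carrier G \<Longrightarrow> x \<noteq> \<one> \<Longrightarrow>
      \<exists>y\<in>carrier G. \<forall>z\<in>carrier G. \<not> (x \<in> generate G {z} \<and> y \<in> generate G {z})"
  shows "eccentric_subgraph (enhanced_power_graph G) =
    pre_digraph.del_vert (enhanced_power_graph G) \<one>"
proof -
  let ?P = "enhanced_power_graph G"
  interpret P: wf_digraph ?P
    by (rule wf_digraph_enhanced_power_graph)
  have gen: "x \<in> generate G {x}" "\<one> \<in> generate G {x}" for x
    by (auto intro: generate.intros)
  have "eccentric_verts ?P = verts ?P - {\<one>}"
  proof (rule P.eccentric_verts_unique_dominating)
    fix x assume x: "x \<in> verts ?P" "x \<noteq> \<one>"
    then show "\<one> \<rightarrow>\<^bsub>?P\<^esub> x \<and> x \<rightarrow>\<^bsub>?P\<^esub> \<one>"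
      using gen by auto
    from x partner obtain y where y: "y \<in> carrier G"
        "\<forall>z\<in>carrier G. \<not> (x \<in> generate G {z} \<and> y \<in> generate G {z})"
      by auto
    then have "y \<noteq> x"
      using gen by auto
    with y show "\<exists>y\<in>verts ?P. y \<noteq> x \<and> \<not> x \<rightarrow>\<^bsub>?P\<^esub> y"
      by auto
  qed (use fin nontriv in auto)
  then show ?thesis
    unfolding eccentric_subgraph_def
    using induce_subgraph_minus_vertex[OF wf_digraph_enhanced_power_graph] by metis
qed


section \<open>Non-cocyclic elements in semidihedral groups\<close>

text \<open>
  The locale describes the semidihedral group by two generators rather than by words. The order of
  \<open>a\<close> is prescribed exactly, which excludes the proper quotients in which powers of \<open>a\<close> are
  identified.
\<close>
locale semidihedral_generators = group G for G (structure) +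
  fixes n :: nat and a b
  assumes n_ge_2: "2 \<le> n"
    and a_closed [simp]: "a \<in> carrier G" and b_closed [simp]: "b \<in> carrier G"
    and generated: "generate G {a, b} = carrier G"
    and ord_a: "ord a = 4 * n"
    and b_b: "b \<otimes> b = \<one>"
    and b_a: "b \<otimes> a = a [^] (2 * n - 1) \<otimes> b"
begin

lemma a_pow_eq_one_iff: "a [^] (i::nat) = \<one> \<longleftrightarrow> 4 * n dvd i"
  by (simp add: pow_eq_id ord_a)

lemma b_a_pow: "b \<otimes> a [^] (k::nat) = a [^] ((2 * n - 1) * k) \<otimes> b"
proof (induction k)
  case (Suc k)
  have "b \<otimes> a [^] Suc k = (b \<otimes> a [^] k) \<otimes> a"
    by (simp add: m_assoc)
  also have "\<dots> = a [^] ((2 * n - 1) * k) \<otimes> (b \<otimes> a)"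
    by (simp add: Suc.IH m_assoc)
  also have "\<dots> = a [^] ((2 * n - 1) * Suc k) \<otimes> b"
    by (simp add: b_a nat_pow_mult add.commute flip: m_assoc)
  finally show ?case .
qed simp

lemma a_pow_b_mult:
  "(a [^] (i::nat) \<otimes> b) \<otimes> a [^] (k::nat) = a [^] (i + (2 * n - 1) * k) \<otimes> b"
  by (simp add: m_assoc b_a_pow) (simp add: nat_pow_mult flip: m_assoc)

lemma a_pow_b_mult_b:
  "(a [^] (i::nat) \<otimes> b) \<otimes> (a [^] (k::nat) \<otimes> b) = a [^] (i + (2 * n - 1) * k)"
proof -
  have "(a [^] i \<otimes> b) \<otimes> (a [^] k \<otimes> b) = ((a [^] i \<otimes> b) \<otimes> a [^] k) \<otimes> b"
    by (simp add: m_assoc)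
  also have "\<dots> = a [^] (i + (2 * n - 1) * k)"
    by (simp only: a_pow_b_mult) (simp add: m_assoc b_b)
  finally show ?thesis .
qed

text \<open>
  The relation \<open>b a\<^sup>k = a\<^bsup>(2n-1)k\<^esup> b\<close> moves every \<open>b\<close> to the right, where pairs of \<open>b\<close> cancel;
  so the elements of these two shapes are closed under products and inverses.
\<close>
lemma normal_form:
  assumes "x \<in> carrier G"
  obtains i where "x = a [^] (i::nat)" | i where "x = a [^] (i::nat) \<otimes> b"
proof -
  have "x \<in> generate G {a, b}"
    using assms generated by simp
  then have "\<exists>i::nat. x = a [^] i \<or> x = a [^] i \<otimes> b"
  proof induction
    case one
    show ?case
      by (rule exI[of _ 0]) simp
  next
    case (incl h)
    then show ?case
    proof (elim insertE emptyE)
      assume "h = a" then show ?thesis by (intro exI[of _ 1]) simp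
    next
      assume "h = b" then show ?thesis by (intro exI[of _ 0]) simp
    qed
  next
    case (inv h)
    then show ?case
    proof (elim insertE emptyE)
      assume h: "h = a"
      have "a [^] (4 * n - 1) \<otimes> a = a [^] (4 * n)"
        using n_ge_2 by (simp flip: nat_pow_Suc)
      then have "inv a = a [^] (4 * n - 1)"
        by (intro inv_equality) (simp_all add: a_pow_eq_one_iff)
      with h show ?thesis by blast
    next
      assume "h = b"
      moreover have "inv b = a [^] (0::nat) \<otimes> b"
        using b_b by (intro inv_equality) simp_all
      ultimately show ?thesis by blast
    qed
  next
    case (eng g h)
    from eng.IH obtain i k :: nat
      where g: "g = a [^] i \<or> g = a [^] i \<otimes> b" and h: "h = a [^] k \<or> h = a [^] k \<otimes> b"
      by blast
    have "a [^] i \<otimes> a [^] k = a [^] (i + k)"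
      by (simp add: nat_pow_mult)
    moreover have "a [^] i \<otimes> (a [^] k \<otimes> b) = a [^] (i + k) \<otimes> b"
      by (simp add: nat_pow_mult flip: m_assoc)
    moreover note a_pow_b_mult[of i k] a_pow_b_mult_b[of i k]
    ultimately show ?case
      using g h by blast
  qed
  then show thesis
    using that by blast
qed

lemma finite_carrier: "finite (carrier G)"
proof (rule finite_subset)
  have red: "a [^] i = a [^] (i mod (4 * n))" for i :: nat
  proof -
    have "a [^] i = (a [^] (4 * n)) [^] (i div (4 * n)) \<otimes> a [^] (i mod (4 * n))"
      by (simp add: nat_pow_pow nat_pow_mult)
    also have "a [^] (4 * n) = \<one>"
      by (simp add: a_pow_eq_one_iff)
    finally show ?thesis
      by simp
  qed
  show "carrier G \<subseteq> (\<lambda>i. a [^] i) ` {..<4 * n} \<union> (\<lambda>i. a [^] i \<otimes> b) ` {..<4 * n}"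
  proof
    have range: "i mod (4 * n) \<in> {..<4 * n}" for i
      using n_ge_2 by simp
    fix x assume "x \<in> carrier G"
    then show "x \<in> (\<lambda>i. a [^] i) ` {..<4 * n} \<union> (\<lambda>i. a [^] i \<otimes> b) ` {..<4 * n}"
    proof (cases rule: normal_form)
      case (1 i)
      then show ?thesis
        using red[of i] range[of i] by blast
    next
      case (2 i)
      then show ?thesis
        using red[of i] range[of i] by (metis UnI2 imageI)
    qed
  qed
qed simp

text \<open>
  If \<open>a\<close> and \<open>b\<close> commuted, then \<open>a\<^bsup>2n-2\<^esup> = e\<close>. This is impossible, as \<open>0 < 2n - 2 < 4n\<close>;
  the lower bound is where \<open>n \<ge> 2\<close> enters.
\<close>
lemma b_a_noncommute: "b \<otimes> a \<noteq> a \<otimes> b"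
proof
  assume "b \<otimes> a = a \<otimes> b"
  then have "a [^] (2 * n - 1) \<otimes> b = a \<otimes> b"
    by (simp add: b_a)
  then have "a [^] (2 * n - 1) = a"
    by simp
  moreover have "a [^] (2 * n - 1) = a [^] (2 * n - 2) \<otimes> a"
  proof -
    have "2 * n - 1 = Suc (2 * n - 2)"
      using n_ge_2 by simp
    then show ?thesis
      by (simp only: nat_pow_Suc)
  qed
  ultimately have "a [^] (2 * n - 2) \<otimes> a = a"
    by metis
  then have "a [^] (2 * n - 2) = \<one>"
    by (metis a_closed nat_pow_closed r_cancel_one)
  then have "4 * n dvd 2 * n - 2"
    by (simp only: a_pow_eq_one_iff)
  then show False
    using n_ge_2 by (auto dest!: dvd_imp_le)
qed

lemma b_neq_a_pow: "b \<noteq> a [^] (i::nat)"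
proof
  assume "b = a [^] i"
  then have "b \<otimes> a = a \<otimes> b"
    by (metis a_closed nat_pow_Suc nat_pow_Suc2)
  then show False
    by (simp add: b_a_noncommute)
qed

lemma a_pow_b_square: "(a [^] (k::nat) \<otimes> b) \<otimes> (a [^] k \<otimes> b) = a [^] (2 * n * k)"
proof -
  have "k + (2 * n - 1) * k = 2 * n * k"
  proof -
    have "k + (2 * n - 1) * k = Suc (2 * n - 1) * k"
      by simp
    also have "Suc (2 * n - 1) = 2 * n"
      using n_ge_2 by simp
    finally show ?thesis .
  qed
  then show ?thesis
    by (simp only: a_pow_b_mult_b)
qed

text \<open>
  By the previous lemma, \<open>(a\<^sup>k b)\<^sup>2\<close> is a power of \<open>a\<^sup>2\<^sup>n\<close>, which gives closed forms for all powers
  of \<open>a\<^sup>k b\<close> according to the parity of the exponent.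
\<close>
lemma a_pow_b_pow_even: "(a [^] (k::nat) \<otimes> b) [^] (2 * q) = a [^] (2 * n * k * q)"
proof -
  have "(a [^] k \<otimes> b) [^] (2 * q) = ((a [^] k \<otimes> b) [^] (2::nat)) [^] q"
    by (simp add: nat_pow_pow)
  also have "(a [^] k \<otimes> b) [^] (2::nat) = a [^] (2 * n * k)"
    using a_pow_b_square by (simp add: numeral_2_eq_2)
  finally show ?thesis
    by (simp add: nat_pow_pow)
qed

lemma a_pow_b_pow_odd:
  "(a [^] (k::nat) \<otimes> b) [^] (Suc (2 * q)) = a [^] (k * (2 * n * q + 1)) \<otimes> b"
proof -
  have "(a [^] k \<otimes> b) [^] (Suc (2 * q)) = a [^] (2 * n * k * q) \<otimes> (a [^] k \<otimes> b)"
    by (simp only: nat_pow_Suc a_pow_b_pow_even)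
  also have "\<dots> = a [^] (2 * n * k * q + k) \<otimes> b"
    by (simp add: nat_pow_mult flip: m_assoc)
  also have "2 * n * k * q + k = k * (2 * n * q + 1)"
    by (simp add: algebra_simps)
  finally show ?thesis .
qed

text \<open>
  A power of \<open>z = a\<^sup>i\<close> is a power of \<open>a\<close> and so never \<open>b\<close>; the same holds for an even power of
  \<open>z = a\<^sup>k b\<close>. An odd power of \<open>a\<^sup>k b\<close> is \<open>a\<^bsup>k(2nq+1)\<^esup> b\<close>. It equals \<open>b\<close> only if \<open>4n\<close> divides
  \<open>k(2nq+1)\<close>, and as \<open>2nq + 1\<close> is coprime to \<open>4n\<close> this forces \<open>a\<^sup>k = e\<close>.
\<close>
lemma generator_of_b:
  assumes z: "z \<in> carrier G" and b: "b \<in> generate G {z}"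
  shows "z = b"
proof -
  from b obtain m :: nat where m: "b = z [^] m"
    using generate_pow_on_finite_carrier[OF finite_carrier z] by auto
  from z show ?thesis
  proof (cases rule: normal_form)
    case (1 i)
    then have "b = a [^] (i * m)"
      using m by (simp add: nat_pow_pow)
    then show ?thesis
      by (simp add: b_neq_a_pow)
  next
    case (2 k)
    obtain q where q: "m = Suc (2 * q)"
    proof (cases "even m")
      case True
      then obtain q where "m = 2 * q" by blast
      then have "b = a [^] (2 * n * k * q)"
        using m 2 a_pow_b_pow_even by simp
      then show ?thesis
        by (simp add: b_neq_a_pow)
    next
      case False
      then show ?thesis
        using that by (metis oddE Suc_eq_plus1)
    qed
    have "b = a [^] (k * (2 * n * q + 1)) \<otimes> b"
      using m 2 q a_pow_b_pow_odd by metis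
    then have "a [^] (k * (2 * n * q + 1)) = \<one>"
      by (metis a_closed b_closed nat_pow_closed l_cancel_one r_cancel_one)
    then have "4 * n dvd k * (2 * n * q + 1)"
      by (simp only: a_pow_eq_one_iff)
    moreover have "coprime (2 * n) (2 * n * q + 1)"
      by (metis coprime_1_right coprime_iff_gcd_eq_1 gcd_add_mult mult.commute add.commute)
    then have "coprime (2 * (2 * n)) (2 * n * q + 1)"
      unfolding coprime_mult_left_iff by blast
    then have "coprime (4 * n) (2 * n * q + 1)"
      by simp
    ultimately have "4 * n dvd k"
      by (metis coprime_dvd_mult_left_iff)
    then show ?thesis
      using 2 a_pow_eq_one_iff by simp
  qed
qed

text \<open>
  The partner of \<open>a\<^sup>i\<close> is \<open>b\<close>, by maximality of the cyclic subgroup \<open>{e, b}\<close>; the partner of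
  \<open>a\<^sup>i b\<close> is \<open>a\<close>, since elements of a common cyclic subgroup commute.
\<close>
lemma ex_not_cocyclic:
  assumes x: "x \<in> carrier G" "x \<noteq> \<one>"
  shows "\<exists>y\<in>carrier G. \<forall>z\<in>carrier G. \<not> (x \<in> generate G {z} \<and> y \<in> generate G {z})"
  using x(1)
proof (cases rule: normal_form)
  case (1 i)
  have "\<not> (x \<in> generate G {z} \<and> b \<in> generate G {z})" if z: "z \<in> carrier G" for z
  proof
    assume xb: "x \<in> generate G {z} \<and> b \<in> generate G {z}"
    with z have "z = b"
      using generator_of_b by blast
    with xb obtain m :: nat where m: "x = b [^] m"
      using generate_pow_on_finite_carrier[OF finite_carrier b_closed] by auto
    obtain q where "m = 2 * q \<or> m = Suc (2 * q)"
      by (metis evenE oddE Suc_eq_plus1)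
    moreover have "b [^] (2 * q) = \<one>"
      using a_pow_b_pow_even[of 0 q] by simp
    ultimately have "x = \<one> \<or> x = b"
      using m by auto
    then show False
      using x(2) 1 b_neq_a_pow by metis
  qed
  then show ?thesis
    by (intro bexI[of _ b]) auto
next
  case (2 i)
  have "\<not> (x \<in> generate G {z} \<and> a \<in> generate G {z})" if z: "z \<in> carrier G" for z
  proof
    assume "x \<in> generate G {z} \<and> a \<in> generate G {z}"
    then obtain k m :: nat where km: "x = z [^] k" "a = z [^] m"
      using generate_pow_on_finite_carrier[OF finite_carrier z] by auto
    then have "x \<otimes> a = a \<otimes> x"
      using z by (simp add: nat_pow_mult add.commute)
    then have "a [^] i \<otimes> (b \<otimes> a) = a [^] i \<otimes> (a \<otimes> b)"
    proof -
      have "a [^] i \<otimes> (b \<otimes> a) = x \<otimes> a"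
        using 2 by (simp add: m_assoc)
      also have "\<dots> = (a \<otimes> a [^] i) \<otimes> b"
        using 2 \<open>x \<otimes> a = a \<otimes> x\<close> by (simp add: m_assoc)
      also have "a \<otimes> a [^] i = a [^] i \<otimes> a"
        by (metis a_closed nat_pow_Suc nat_pow_Suc2)
      finally show ?thesis
        by (simp add: m_assoc)
    qed
    then show False
      using b_a_noncommute by simp
  qed
  then show ?thesis
    by (intro bexI[of _ a]) auto
qed

end


section \<open>Presented groups\<close>

lemma equiv_word_rel: "equiv UNIV (word_rel R)"
  unfolding word_rel_def equiv_def
  by (auto intro!: refl_onI symI transI elim: equivclp_sym equivclp_trans)

lemma word_step_imp_word_rel: "word_step R u v \<Longrightarrow> (u, v) \<in> word_rel R"
  by (auto simp: word_rel_def)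

text \<open>
  This is the way to show that two words represent different elements: a function on words that no
  elementary step changes is constant on the classes.
\<close>
lemma word_rel_invariant:
  assumes "(u, v) \<in> word_rel R" and "\<And>u v. word_step R u v \<Longrightarrow> f u = f v"
  shows "f u = f v"
proof -
  have "equivclp (word_step R) u v"
    using assms(1) by (simp add: word_rel_def)
  then show ?thesis
    by (induction rule: equivclp_induct) (use assms(2) in auto)
qed

lemma word_step_append:
  assumes "word_step R u v"
  shows "word_step R (p @ u @ s) (p @ v @ s)"
  using assms
proof cases
  case (cancel u' g t v')
  then show ?thesis
    using word_step.cancel[of R "p @ u'" g t "v' @ s"] by simp
next
  case (relation l r u' v')
  then show ?thesis
    using word_step.relation[of l r R "p @ u'" "v' @ s"] by simp
qed

lemma word_rel_append:
  assumes "(u, v) \<in> word_rel R"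
  shows "(p @ u @ s, p @ v @ s) \<in> word_rel R"
proof -
  have "equivclp (word_step R) u v"
    using assms by (simp add: word_rel_def)
  then have "equivclp (word_step R) (p @ u @ s) (p @ v @ s)"
  proof (induction rule: equivclp_induct)
    case (step y z)
    then have "equivclp (word_step R) (p @ y @ s) (p @ z @ s)"
      using word_step_append by (metis r_into_equivclp equivclp_sym)
    with step.IH show ?case
      by (rule equivclp_trans)
  qed simp
  then show ?thesis
    by (simp add: word_rel_def)
qed

definition word_class :: "('g word \<times> 'g word) set \<Rightarrow> 'g word \<Rightarrow> 'g word set" where
  "word_class R w = word_rel R `` {w}"

lemma word_class_eq_iff: "word_class R u = word_class R v \<longleftrightarrow> (u, v) \<in> word_rel R"
  unfolding word_class_def using eq_equiv_class_iff[OF equiv_word_rel] by auto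

lemma carrier_presented_group: "carrier (presented_group R) = range (word_class R)"
  by (auto simp: presented_group_def quotient_def word_class_def)

lemma one_presented_group: "\<one>\<^bsub>presented_group R\<^esub> = word_class R []"
  by (simp add: presented_group_def word_class_def)

lemma mult_presented_group:
  "word_class R u \<otimes>\<^bsub>presented_group R\<^esub> word_class R v = word_class R (u @ v)"
proof -
  have "congruent2 (word_rel R) (word_rel R) (\<lambda>u v. word_class R (u @ v))"
  proof (rule congruent2I[OF equiv_word_rel equiv_word_rel])
    fix u v w :: "'a word"
    assume "(u, v) \<in> word_rel R"
    then show "word_class R (u @ w) = word_class R (v @ w)" "word_class R (w @ u) = word_class R (w @ v)"
      using word_rel_append[of u v R "[]" w] word_rel_append[of u v R w "[]"]
      by (simp_all add: word_class_eq_iff)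
  qed
  from UN_equiv_class2[OF equiv_word_rel equiv_word_rel this, of u v] show ?thesis
    by (simp add: presented_group_def word_class_def)
qed

lemmas presented_group_simps = carrier_presented_group one_presented_group mult_presented_group

lemma relation_holds: "(l, r) \<in> R \<Longrightarrow> word_class R l = word_class R r"
  using word_step.relation[of l r R "[]" "[]"]
  by (simp add: word_class_eq_iff word_step_imp_word_rel)

lemma word_class_cancel: "word_class R [(g, s), (g, \<not> s)] = word_class R []"
  using word_step.cancel[of R "[]" g s "[]"]
  by (simp add: word_class_eq_iff word_step_imp_word_rel)

text \<open>
  Only left inverses need an argument. The inverse word is built along \<open>w\<close>: prepending a letter to
  \<open>w\<close> is compensated by appending its formal inverse to the word that cancels \<open>w\<close>.
\<close>
lemma group_presented_group: "group (presented_group R)"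
proof (rule groupI)
  fix x assume "x \<in> carrier (presented_group R)"
  then obtain w where x: "x = word_class R w"
    by (auto simp: presented_group_simps)
  have "\<exists>v. (v @ w, []) \<in> word_rel R"
  proof (induction w)
    case Nil
    show ?case
      using word_class_eq_iff by (metis append_Nil)
  next
    case (Cons l w)
    then obtain v where v: "(v @ w, []) \<in> word_rel R"
      by blast
    obtain g s where l: "l = (g, s)"
      by fastforce
    have "word_step R (v @ [(g, \<not> s), (g, \<not> \<not> s)] @ w) (v @ w)"
      by (rule word_step.cancel)
    then have "((v @ [(g, \<not> s)]) @ l # w, v @ w) \<in> word_rel R"
      by (simp add: l word_step_imp_word_rel)
    with v show ?case
      using word_class_eq_iff by metis
  qed
  then show "\<exists>y\<in>carrier (presented_group R). y \<otimes>\<^bsub>presented_group R\<^esub> x = \<one>\<^bsub>presented_group R\<^esub>"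
    by (auto simp: presented_group_simps x word_class_eq_iff)
qed (auto simp: presented_group_simps)

lemma word_class_replicate:
  "word_class R (replicate k (g, s)) = word_class R [(g, s)] [^]\<^bsub>presented_group R\<^esub> k"
proof -
  interpret group "presented_group R"
    by (rule group_presented_group)
  show ?thesis
  proof (induction k)
    case (Suc k)
    have "word_class R (replicate (Suc k) (g, s)) =
        word_class R (replicate k (g, s)) \<otimes>\<^bsub>presented_group R\<^esub> word_class R [(g, s)]"
      by (simp add: mult_presented_group replicate_append_same)
    with Suc show ?case
      by simp
  qed (simp add: one_presented_group)
qed

text \<open>
  A word is the product of its letters, and the class of a formal inverse \<open>(g, False)\<close> is the inverse
  of the class of \<open>(g, True)\<close>.
\<close>
lemma presented_group_generated:
  "generate (presented_group R) (range (\<lambda>g. word_class R [(g, True)])) = carrier (presented_group R)"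
    (is "generate ?G ?S = _")
proof
  interpret group ?G
    by (rule group_presented_group)
  have S: "?S \<subseteq> carrier ?G"
    by (auto simp: carrier_presented_group)
  then show "generate ?G ?S \<subseteq> carrier ?G"
    by (rule generate_incl)
  have letter: "word_class R [(g, s)] \<in> generate ?G ?S" for g s
  proof (cases s)
    case False
    have "word_class R [(g, False)] \<otimes>\<^bsub>?G\<^esub> word_class R [(g, True)] = \<one>\<^bsub>?G\<^esub>"
      using word_class_cancel[of R g False] by (simp add: presented_group_simps)
    then have "inv\<^bsub>?G\<^esub> (word_class R [(g, True)]) = word_class R [(g, False)]"
      by (intro inv_equality) (auto simp: carrier_presented_group)
    then show ?thesis
      using False generate.inv[of "word_class R [(g, True)]" ?S ?G] by auto
  qed (auto intro: generate.incl)
  have "word_class R w \<in> generate ?G ?S" for w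
  proof (induction w)
    case Nil
    show ?case
      using generate.one[of ?G ?S] by (simp add: one_presented_group)
  next
    case (Cons l w)
    have "word_class R (l # w) = word_class R [l] \<otimes>\<^bsub>?G\<^esub> word_class R w"
      by (simp add: mult_presented_group)
    with Cons letter show ?case
      by (metis generate.eng surj_pair)
  qed
  then show "carrier ?G \<subseteq> generate ?G ?S"
    by (auto simp: carrier_presented_group)
qed


section \<open>The presentation of the semidihedral group\<close>

text \<open>
  A lower bound for the order of \<open>a\<close> needs a model of the presentation. The affine maps
  \<open>x \<mapsto> x + 1\<close> and \<open>x \<mapsto> (2n-1)x\<close> satisfy the relations modulo \<open>4n\<close>. Letters act on the integers
  themselves and values are reduced only at the end; this is harmless because affine maps respect
  congruences. Both \<open>b\<close> and its formal inverse act as multiplication by \<open>2n - 1\<close>, which is its own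
  inverse modulo \<open>4n\<close>.
\<close>
fun letter_act :: "nat \<Rightarrow> sd_gen \<times> bool \<Rightarrow> int \<Rightarrow> int" where
  "letter_act n (Gen_a, s) x = (if s then x + 1 else x - 1)"
| "letter_act n (Gen_b, s) x = (2 * int n - 1) * x"

definition word_act :: "nat \<Rightarrow> sd_gen word \<Rightarrow> int \<Rightarrow> int" where
  "word_act n w x = foldr (letter_act n) w x mod (4 * int n)"

abbreviation sd_rels :: "nat \<Rightarrow> (sd_gen word \<times> sd_gen word) set" where
  "sd_rels n \<equiv>
     {(replicate (4 * n) letter_a, []),
      ([letter_b, letter_b], []),
      ([letter_b, letter_a], replicate (2 * n - 1) letter_a @ [letter_b])}"

lemma foldr_letter_act_cong:
  assumes "x mod (4 * int n) = y mod (4 * int n)"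
  shows "foldr (letter_act n) w x mod (4 * int n) = foldr (letter_act n) w y mod (4 * int n)"
proof (induction w)
  case (Cons l w)
  obtain g s where l: "l = (g, s)"
    by fastforce
  show ?case
    using Cons by (cases g; cases s) (auto simp: l intro: mod_add_cong mod_diff_cong mod_mult_cong)
qed (use assms in simp)

lemma foldr_replicate_a: "foldr (letter_act n) (replicate k letter_a) x = x + int k"
  by (induction k) auto

lemma square_mod: "(2 * int n - 1) * ((2 * int n - 1) * x) mod (4 * int n) = x mod (4 * int n)"
proof -
  have "(2 * int n - 1) * ((2 * int n - 1) * x) = x + 4 * int n * ((int n - 1) * x)"
    by (simp add: algebra_simps)
  then show ?thesis
    by simp
qed

text \<open>
  Words with the same action remain so inside any context, hence it suffices to check the cancelling
  pairs and the three relations on their own. The third holds because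
  \<open>(2n-1)(x+1) = (2n-1)x + (2n-1)\<close>.
\<close>
lemma word_act_step:
  assumes "n \<ge> 2" "word_step (sd_rels n) u v"
  shows "word_act n u = word_act n v"
proof -
  have inner: "word_act n (p @ l @ s) = word_act n (p @ r @ s)" if "word_act n l = word_act n r"
    for p l r s
  proof
    fix x
    have "foldr (letter_act n) l y mod (4 * int n) = foldr (letter_act n) r y mod (4 * int n)" for y
      using fun_cong[OF that] by (simp add: word_act_def)
    then show "word_act n (p @ l @ s) x = word_act n (p @ r @ s) x"
      unfolding word_act_def foldr_append o_apply by (rule foldr_letter_act_cong)
  qed
  from assms(2) show ?thesis
  proof cases
    case (cancel p g t s)
    have "word_act n [(g, t), (g, \<not> t)] = word_act n []"
      by (cases g) (auto simp: word_act_def square_mod)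
    from inner[OF this, of p s] show ?thesis
      using cancel by simp
  next
    case (relation l r p s)
    have "word_act n (replicate (4 * n) letter_a) = word_act n []"
      by (simp add: fun_eq_iff word_act_def foldr_replicate_a del: foldr_replicate)
    moreover have "word_act n [letter_b, letter_b] = word_act n []"
      by (simp add: fun_eq_iff word_act_def square_mod)
    moreover have "word_act n [letter_b, letter_a] = word_act n (replicate (2 * n - 1) letter_a @ [letter_b])"
      using assms(1)
      by (simp add: fun_eq_iff word_act_def foldr_replicate_a of_nat_diff algebra_simps del: foldr_replicate)
    ultimately have "word_act n l = word_act n r"
      using relation(3) by auto
    from inner[OF this, of p s] show ?thesis
      using relation by simp
  qed
qed

text \<open>
  The relations hold by construction. For the order of \<open>a\<close>, the word \<open>a\<^sup>k\<close> sends \<open>0\<close> to \<open>k\<close>, so it can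
  be trivial only if \<open>4n\<close> divides \<open>k\<close>.
\<close>
lemma semidihedral_generators_semidihedral:
  assumes "n \<ge> 2"
  shows "semidihedral_generators (semidihedral n) n
    (word_class (sd_rels n) [letter_a]) (word_class (sd_rels n) [letter_b])"
proof -
  let ?R = "sd_rels n"
  let ?G = "presented_group ?R"
  let ?a = "word_class ?R [letter_a]" and ?b = "word_class ?R [letter_b]"
  interpret group ?G
    by (rule group_presented_group)
  have a_pow: "?a [^]\<^bsub>?G\<^esub> (k::nat) = word_class ?R (replicate k letter_a)" for k
    by (rule word_class_replicate[symmetric])
  have dvd: "4 * n dvd k" if "?a [^]\<^bsub>?G\<^esub> (k::nat) = \<one>\<^bsub>?G\<^esub>" for k
  proof -
    have "(replicate k letter_a, []) \<in> word_rel ?R"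
      using that by (simp only: a_pow one_presented_group word_class_eq_iff)
    then have "word_act n (replicate k letter_a) = word_act n []"
      by (rule word_rel_invariant) (rule word_act_step[OF assms])
    from fun_cong[OF this, of 0] have "int k mod int (4 * n) = 0"
      by (simp add: word_act_def foldr_replicate_a del: foldr_replicate)
    then show ?thesis
      by (metis int_dvd_int_iff mod_eq_0_iff_dvd)
  qed
  have "?a [^]\<^bsub>?G\<^esub> (4 * n) = \<one>\<^bsub>?G\<^esub>"
    unfolding a_pow one_presented_group by (rule relation_holds) simp
  then have "?a [^]\<^bsub>?G\<^esub> k = \<one>\<^bsub>?G\<^esub>" if "4 * n dvd k" for k
    using that by (metis carrier_presented_group rangeI dvdE nat_pow_pow nat_pow_one)
  with dvd have ord: "ord ?a = 4 * n"
    by (subst ord_unique) (auto simp: carrier_presented_group)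
  have gens: "UNIV = {Gen_a, Gen_b}"
    using sd_gen.exhaust by blast
  then have gen: "generate ?G {?a, ?b} = carrier ?G"
    using presented_group_generated[of ?R] by (simp only: gens image_insert image_empty)
  have "?b \<otimes>\<^bsub>?G\<^esub> ?b = \<one>\<^bsub>?G\<^esub>"
    unfolding mult_presented_group one_presented_group by (rule relation_holds) simp
  moreover have "?b \<otimes>\<^bsub>?G\<^esub> ?a = ?a [^]\<^bsub>?G\<^esub> (2 * n - 1) \<otimes>\<^bsub>?G\<^esub> ?b"
    unfolding mult_presented_group a_pow by (rule relation_holds) simp
  ultimately show ?thesis
    unfolding semidihedral_def using assms gen ord
    by unfold_locales (auto simp: carrier_presented_group)
qed

theorem theorem3p9:
  fixes n :: nat
  assumes "n \<ge> 2"
  shows "eccentric_subgraph (enhanced_power_graph (semidihedral n)) =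
         pre_digraph.del_vert (enhanced_power_graph (semidihedral n)) \<one>\<^bsub>semidihedral n\<^esub>"
proof -
  interpret semidihedral_generators "semidihedral n" n
      "word_class (sd_rels n) [letter_a]" "word_class (sd_rels n) [letter_b]"
    by (rule semidihedral_generators_semidihedral[OF assms])
  show ?thesis
  proof (rule eccentric_subgraph_enhanced_power_graph)
    show "carrier (semidihedral n) \<noteq> {\<one>\<^bsub>semidihedral n\<^esub>}"
      using a_closed b_closed b_a_noncommute by (metis singletonD)
  qed (use finite_carrier ex_not_cocyclic in auto)
qed

end
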